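(* Let $\lambda=m\varpi_1+n\varpi_2+k\varpi_3$ and $\mu=x\varpi_1+y\varpi_2+z\varpi_3$ range over all pairs of weights of $\mathfrak{sp}_6(\mathbb{C})$ with $m,n,k,x,y,z\in\mathbb{N}$ and $\frac{m+k+x+z}{2}\in\mathbb{N}$. Then there are exactly $46$ distinct Weyl alternation sets $\mathcal{A}(\lambda,\mu)$, and they are the following subsets of the Weyl group (each letter denotes the Weyl group element assigned to it in the context): (1) $\{\}$; (2) $\{A\}$; (3) $\{C,A\}$; (4) $\{A,B\}$; (5) $\{A,D\}$; (6) $\{C,A,B\}$; (7) $\{C,A,D\}$; (8) $\{C,F,A,B\}$; (9) $\{C,A,D,I\}$; (10) $\{C,A,D,G\}$; (11) $\{A,B,H,D\}$; (12) $\{C,A,B,H,D\}$; (13) $\{C,A,D,I,G\}$; (14) $\{J,C,E,F,A,B\}$; (15) $\{C,F,A,B,H,D\}$; (16) $\{C,A,B,H,D,I\}$; (17) $\{C,A,B,H,D,G\}$; (18) $\{C,A,D,I,G,L\}$; (19) $\{C,F,A,B,H,D,I\}$; (20) $\{C,F,A,B,H,D,G\}$; (21) $\{C,A,B,H,D,I,G\}$; (22) $\{J,C,E,F,A,B,H,D\}$; (23) $\{C,F,A,K,B,H,D,G\}$; (24) $\{C,F,A,B,H,D,I,G\}$; (25) $\{C,A,B,H,D,I,G,L\}$; (26) $\{C,A,O,D,Q,I,G,L\}$; (27) $\{J,C,E,F,A,B,H,D,G\}$; (28) $\{C,F,A,K,B,H,D,I,G\}$; (29) $\{C,F,A,B,H,D,I,G,L\}$;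 (30) $\{N,J,C,E,F,A,B,H,D,I\}$; (31) $\{J,C,E,F,A,K,B,H,D,G\}$; (32) $\{C,F,A,K,B,H,D,I,G,L\}$; (33) $\{C,A,B,H,O,D,Q,I,G,L\}$; (34) $\{N,J,C,E,F,A,B,H,D,I,G\}$; (35) $\{C,F,A,B,H,O,D,Q,I,G,L\}$; (36) $\{N,J,C,E,F,A,K,B,H,D,I,G\}$; (37) $\{N,J,C,E,F,A,B,P,H,D,I,M\}$; (38) $\{N,J,C,E,F,A,B,H,D,I,G,L\}$; (39) $\{C,F,A,K,B,H,O,D,Q,I,G,L\}$; (40) $\{N,J,C,E,F,A,K,B,H,D,I,G,L\}$; (41) $\{N,J,C,E,F,A,B,P,H,D,I,G,M\}$; (42) $\{N,J,C,E,F,A,K,B,P,H,D,I,G,M\}$; (43) $\{N,J,C,E,F,A,B,P,H,D,I,G,M,L\}$; (44) $\{N,J,C,E,F,A,B,H,O,D,Q,I,G,L\}$; (45) $\{N,J,C,E,F,A,K,B,P,H,D,I,G,M,L\}$; (46) $\{N,J,C,E,F,A,K,B,H,O,D,Q,I,G,L\}$.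
   Context: $\mathbb{N}=\{0,1,2,\ldots\}$. The simple roots of $\mathfrak{sp}_6(\mathbb{C})$ (type $C_3$) are $\alpha_1=\varepsilon_1-\varepsilon_2$, $\alpha_2=\varepsilon_2-\varepsilon_3$, $\alpha_3=2\varepsilon_3$ in $\mathbb{R}^3$ with standard basis $\varepsilon_1,\varepsilon_2,\varepsilon_3$. The positive roots are $$\Phi^+=\{\alpha_1,\alpha_2,\alpha_3,\alpha_1+\alpha_2,\alpha_2+\alpha_3,\alpha_1+\alpha_2+\alpha_3,\alpha_1+2\alpha_2+\alpha_3,2\alpha_1+2\alpha_2+\alpha_3,2\alpha_2+\alpha_3\}.$$ The fundamental weights are $\varpi_1=\alpha_1+\alpha_2+\frac12\alpha_3$, $\varpi_2=\alpha_1+2\alpha_2+\alpha_3$, $\varpi_3=\alpha_1+2\alpha_2+\frac32\alpha_3$, and $\rho=\frac12\sum_{\alpha\in\Phi^+}\alpha=\varpi_1+\varpi_2+\varpi_3=3\alpha_1+5\alpha_2+3\alpha_3$. The Weyl group $W$ (of order $48$) is generated by the reflections $s_1,s_2,s_3$ orthogonal to $\alpha_1,\alpha_2,\alpha_3$, acting linearly by $s_1:\alpha_1\mapsto-\alpha_1,\ \alpha_2\mapsto\alpha_1+\alpha_2,\ \alpha_3\mapsto\alpha_3$; $s_2:\alpha_1\mapsto\alpha_1+\alpha_2,\ \alpha_2\mapsto-\alpha_2,\ \alpha_3\mapsto2\alpha_2+\alpha_3$; $s_3:\alpha_1\mapsto\alpha_1,\ \alpha_2\mapsto\alpha_2+\alpha_3,\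 \alpha_3\mapsto-\alpha_3$. Products denote composition (rightmost factor acts first). Kostant's partition function $\wp(\xi)$ is the number of ways to write $\xi$ as a nonnegative integral linear combination of the positive roots in $\Phi^+$. The Weyl alternation set is $$\mathcal{A}(\lambda,\mu)=\{\sigma\in W:\ \wp(\sigma(\lambda+\rho)-\rho-\mu)>0\}.$$ Letters denote the following elements of $W$: $A=1$, $B=s_1$, $C=s_2$, $D=s_3$, $E=s_1s_2$, $F=s_2s_1$, $G=s_2s_3$, $H=s_3s_1$, $I=s_3s_2$, $J=s_1s_2s_1$, $K=s_2s_3s_1$, $L=s_2s_3s_2$, $M=s_3s_2s_1$, $N=s_3s_1s_2$, $O=s_3s_2s_3$, $P=s_3s_1s_2s_1$, $Q=s_3s_2s_3s_2$. *)

theory Defs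
  imports "HOL-Analysis.Analysis" "HOL-Algebra.Generated_Groups" "HOL-Algebra.Bij"
begin

section \<open>The root system of type $C_3$\<close>

definition \<alpha>\<^sub>1 :: "real^3" where "\<alpha>\<^sub>1 = axis 1 1 - axis 2 1"
definition \<alpha>\<^sub>2 :: "real^3" where "\<alpha>\<^sub>2 = axis 2 1 - axis 3 1"
definition \<alpha>\<^sub>3 :: "real^3" where "\<alpha>\<^sub>3 = 2 *\<^sub>R axis 3 1"

definition pos_roots :: "(real^3) set" where
  "pos_roots =
    {\<alpha>\<^sub>1, \<alpha>\<^sub>2, \<alpha>\<^sub>3, \<alpha>\<^sub>1 + \<alpha>\<^sub>2, \<alpha>\<^sub>2 + \<alpha>\<^sub>3, \<alpha>\<^sub>1 + \<alpha>\<^sub>2 + \<alpha>\<^sub>3,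
     \<alpha>\<^sub>1 + 2 *\<^sub>R \<alpha>\<^sub>2 + \<alpha>\<^sub>3, 2 *\<^sub>R \<alpha>\<^sub>1 + 2 *\<^sub>R \<alpha>\<^sub>2 + \<alpha>\<^sub>3, 2 *\<^sub>R \<alpha>\<^sub>2 + \<alpha>\<^sub>3}"

text \<open>The fundamental weights, usually written $\varpi_1,\varpi_2,\varpi_3$.\<close>
definition \<omega>\<^sub>1 :: "real^3" where "\<omega>\<^sub>1 = \<alpha>\<^sub>1 + \<alpha>\<^sub>2 + (1/2) *\<^sub>R \<alpha>\<^sub>3"
definition \<omega>\<^sub>2 :: "real^3" where "\<omega>\<^sub>2 = \<alpha>\<^sub>1 + 2 *\<^sub>R \<alpha>\<^sub>2 + \<alpha>\<^sub>3"
definition \<omega>\<^sub>3 :: "real^3" where "\<omega>\<^sub>3 = \<alpha>\<^sub>1 + 2 *\<^sub>R \<alpha>\<^sub>2 + (3/2) *\<^sub>R \<alpha>\<^sub>3"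

definition dominant_weight :: "nat \<Rightarrow> nat \<Rightarrow> nat \<Rightarrow> real^3" where
  "dominant_weight a b c = real a *\<^sub>R \<omega>\<^sub>1 + real b *\<^sub>R \<omega>\<^sub>2 + real c *\<^sub>R \<omega>\<^sub>3"

definition \<rho> :: "real^3" where "\<rho> = (1/2) *\<^sub>R (\<Sum>\<alpha>\<in>pos_roots. \<alpha>)"

lemma rho_eq:
  "\<rho> = \<omega>\<^sub>1 + \<omega>\<^sub>2 + \<omega>\<^sub>3"
  "\<rho> = 3 *\<^sub>R \<alpha>\<^sub>1 + 5 *\<^sub>R \<alpha>\<^sub>2 + 3 *\<^sub>R \<alpha>\<^sub>3"
  by (simp_all add: \<rho>_def pos_roots_def \<omega>\<^sub>1_def \<omega>\<^sub>2_def \<omega>\<^sub>3_def \<alpha>\<^sub>1_def \<alpha>\<^sub>2_def \<alpha>\<^sub>3_def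
      vec_eq_iff forall_3 axis_def)

section \<open>The Weyl group\<close>

definition refl_orth :: "real^3 \<Rightarrow> real^3 \<Rightarrow> real^3" where
  "refl_orth \<alpha> v = v - (2 * (v \<bullet> \<alpha>) / (\<alpha> \<bullet> \<alpha>)) *\<^sub>R \<alpha>"

definition s\<^sub>1 :: "real^3 \<Rightarrow> real^3" where "s\<^sub>1 = refl_orth \<alpha>\<^sub>1"
definition s\<^sub>2 :: "real^3 \<Rightarrow> real^3" where "s\<^sub>2 = refl_orth \<alpha>\<^sub>2"
definition s\<^sub>3 :: "real^3 \<Rightarrow> real^3" where "s\<^sub>3 = refl_orth \<alpha>\<^sub>3"

text \<open>
  The subgroup generated by the simple reflections inside the group of all bijections of
  $\mathbf{R}^3$, whose multiplication is composition of functions.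
\<close>
definition weyl_group :: "(real^3 \<Rightarrow> real^3) set" where
  "weyl_group = generate (BijGroup UNIV) {s\<^sub>1, s\<^sub>2, s\<^sub>3}"

lemma refl_orth_involutive: "refl_orth \<alpha> (refl_orth \<alpha> v) = v"
  by (cases "\<alpha> = 0") (simp_all add: refl_orth_def algebra_simps)

lemma simple_reflections_in_BijGroup: "{s\<^sub>1, s\<^sub>2, s\<^sub>3} \<subseteq> carrier (BijGroup UNIV)"
proof -
  have "bij (refl_orth \<alpha>)" for \<alpha>
    by (rule involuntory_imp_bij) (rule refl_orth_involutive)
  then show ?thesis
    by (simp add: BijGroup_def Bij_def s\<^sub>1_def s\<^sub>2_def s\<^sub>3_def)
qed

lemma BijGroup_mult_eq_comp:
  assumes "f \<in> carrier (BijGroup UNIV)" "g \<in> carrier (BijGroup UNIV)"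
  shows "f \<otimes>\<^bsub>BijGroup UNIV\<^esub> g = f \<circ> g"
  using assms by (simp add: BijGroup_def compose_def fun_eq_iff)

lemma simple_reflections_simple_roots:
  "s\<^sub>1 \<alpha>\<^sub>1 = - \<alpha>\<^sub>1" "s\<^sub>1 \<alpha>\<^sub>2 = \<alpha>\<^sub>1 + \<alpha>\<^sub>2" "s\<^sub>1 \<alpha>\<^sub>3 = \<alpha>\<^sub>3"
  "s\<^sub>2 \<alpha>\<^sub>1 = \<alpha>\<^sub>1 + \<alpha>\<^sub>2" "s\<^sub>2 \<alpha>\<^sub>2 = - \<alpha>\<^sub>2" "s\<^sub>2 \<alpha>\<^sub>3 = 2 *\<^sub>R \<alpha>\<^sub>2 + \<alpha>\<^sub>3"
  "s\<^sub>3 \<alpha>\<^sub>1 = \<alpha>\<^sub>1" "s\<^sub>3 \<alpha>\<^sub>2 = \<alpha>\<^sub>2 + \<alpha>\<^sub>3" "s\<^sub>3 \<alpha>\<^sub>3 = - \<alpha>\<^sub>3"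
  by (simp_all add: s\<^sub>1_def s\<^sub>2_def s\<^sub>3_def refl_orth_def \<alpha>\<^sub>1_def \<alpha>\<^sub>2_def \<alpha>\<^sub>3_def
      inner_vec_def sum_3 vec_eq_iff forall_3 axis_def)

definition w\<^sub>A :: "real^3 \<Rightarrow> real^3" where "w\<^sub>A = id"
definition w\<^sub>B :: "real^3 \<Rightarrow> real^3" where "w\<^sub>B = s\<^sub>1"
definition w\<^sub>C :: "real^3 \<Rightarrow> real^3" where "w\<^sub>C = s\<^sub>2"
definition w\<^sub>D :: "real^3 \<Rightarrow> real^3" where "w\<^sub>D = s\<^sub>3"
definition w\<^sub>E :: "real^3 \<Rightarrow> real^3" where "w\<^sub>E = s\<^sub>1 \<circ> s\<^sub>2"
definition w\<^sub>F :: "real^3 \<Rightarrow> real^3" where "w\<^sub>F = s\<^sub>2 \<circ> s\<^sub>1"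
definition w\<^sub>G :: "real^3 \<Rightarrow> real^3" where "w\<^sub>G = s\<^sub>2 \<circ> s\<^sub>3"
definition w\<^sub>H :: "real^3 \<Rightarrow> real^3" where "w\<^sub>H = s\<^sub>3 \<circ> s\<^sub>1"
definition w\<^sub>I :: "real^3 \<Rightarrow> real^3" where "w\<^sub>I = s\<^sub>3 \<circ> s\<^sub>2"
definition w\<^sub>J :: "real^3 \<Rightarrow> real^3" where "w\<^sub>J = s\<^sub>1 \<circ> s\<^sub>2 \<circ> s\<^sub>1"
definition w\<^sub>K :: "real^3 \<Rightarrow> real^3" where "w\<^sub>K = s\<^sub>2 \<circ> s\<^sub>3 \<circ> s\<^sub>1"
definition w\<^sub>L :: "real^3 \<Rightarrow> real^3" where "w\<^sub>L = s\<^sub>2 \<circ> s\<^sub>3 \<circ> s\<^sub>2"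
definition w\<^sub>M :: "real^3 \<Rightarrow> real^3" where "w\<^sub>M = s\<^sub>3 \<circ> s\<^sub>2 \<circ> s\<^sub>1"
definition w\<^sub>N :: "real^3 \<Rightarrow> real^3" where "w\<^sub>N = s\<^sub>3 \<circ> s\<^sub>1 \<circ> s\<^sub>2"
definition w\<^sub>O :: "real^3 \<Rightarrow> real^3" where "w\<^sub>O = s\<^sub>3 \<circ> s\<^sub>2 \<circ> s\<^sub>3"
definition w\<^sub>P :: "real^3 \<Rightarrow> real^3" where "w\<^sub>P = s\<^sub>3 \<circ> s\<^sub>1 \<circ> s\<^sub>2 \<circ> s\<^sub>1"
definition w\<^sub>Q :: "real^3 \<Rightarrow> real^3" where "w\<^sub>Q = s\<^sub>3 \<circ> s\<^sub>2 \<circ> s\<^sub>3 \<circ> s\<^sub>2"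

section \<open>Kostant's partition function and Weyl alternation sets\<close>

text \<open>
  A way to write \<open>\<xi>\<close> as a nonnegative integral combination of the positive roots is its
  coefficient function. The set counted is always finite, because every positive root has
  positive inner product with \<open>\<rho>\<close>; so \<open>card\<close> never takes its default value on
  infinite sets.
\<close>
definition kostant_partition :: "real^3 \<Rightarrow> nat" where
  "kostant_partition \<xi> =
    card {c \<in> pos_roots \<rightarrow>\<^sub>E (UNIV :: nat set). (\<Sum>\<alpha>\<in>pos_roots. real (c \<alpha>) *\<^sub>R \<alpha>) = \<xi>}"

definition weyl_alternation_set :: "real^3 \<Rightarrow> real^3 \<Rightarrow> (real^3 \<Rightarrow> real^3) set" where
  "weyl_alternation_set \<Lambda> \<mu> =
    {\<sigma> \<in> weyl_group. kostant_partition (\<sigma> (\<Lambda> + \<rho>) - \<rho> - \<mu>) > 0}"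

end

theory Submission
  imports Defs
begin

text \<open>
  Every positive root is a nonnegative integral combination of simple roots, so \<open>\<wp>(\<xi>) > 0\<close>
  holds exactly when \<open>\<xi>\<close> is such a combination
  (\<open>kostant_partition_pos_iff\<close>). In the coordinates \<open>\<epsilon>\<^sub>1, \<epsilon>\<^sub>2, \<epsilon>\<^sub>3\<close> this
  means that the partial sums of \<open>\<xi>\<close> are nonnegative integers and the total is even. Put
  \<open>l = \<lambda> + \<rho>\<close> and \<open>u = \<mu> + \<rho>\<close>. Both have strictly decreasing positive integral
  coordinates. A Weyl group element \<open>\<sigma>\<close> is a signed permutation of the coordinates,
  which does not change the parity of their sum, and the hypothesis that \<open>m + k + x + z\<close> is
  even says that \<open>l\<close> and \<open>u\<close> have coordinate sums of equal parity. So integrality is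
  automatic, and \<open>\<sigma>\<close> belongs to the alternation set exactly when every partial sum of
  \<open>\<sigma> l\<close> is at least the corresponding partial sum of \<open>u\<close>
  (\<open>in_root_monoid_diff_iff_dominates\<close>, \<open>weyl_alternation_set_eq\<close>).

  For 31 of the 48 signed permutations some partial sum of \<open>\<sigma> l\<close> is negative whatever
  \<open>l\<close> is; the other 17 are the lettered ones. For these, each condition is a comparison of
  a signed sum of \<open>l\<^sub>1 > l\<^sub>2 > l\<^sub>3 > 0\<close> with a partial sum of \<open>u\<close>, and the
  comparisons are related by a short list of implications (\<open>alternation_constraints\<close>),
  each of them linear arithmetic. The list has exactly 46 models, which are the sets in the
  theorem:

  \<^item> without \<open>A\<close>: the empty set;
  \<^item> with \<open>A\<close>, without \<open>D\<close>: any subset of \<open>{B, C}\<close>, and if it is all of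
    \<open>{B, C}\<close> then possibly also \<open>F\<close>, or \<open>F, E, J\<close>; this makes 6;
  \<^item> with \<open>D\<close>, without \<open>B\<close>: either \<open>C\<close> is absent, or \<open>C\<close> comes with one of
    the six ``right hand parts'' \<open>{}\<close>, \<open>I\<close>, \<open>G\<close>, \<open>IG\<close>, \<open>IGL\<close>,
    \<open>IGLOQ\<close>; this makes 7;
  \<^item> with \<open>B\<close> and \<open>D\<close>, hence \<open>H\<close>, without \<open>C\<close>: one set;
  \<^item> with \<open>B\<close>, \<open>C\<close>, \<open>D\<close>: the six right hand parts combine freely with the absence of
    \<open>F\<close> (6 sets), with \<open>F\<close> alone, when \<open>K\<close> is optional in the presence of
    \<open>G\<close> (10 sets), and with \<open>F, E, J\<close>, when \<open>K\<close> is optional as before, \<open>N\<close>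
    accompanies \<open>I\<close>, and the pair \<open>M, P\<close> is optional in the presence of \<open>I\<close> and
    absence of \<open>O, Q\<close> (15 sets).

  Conversely each of the 46 sets occurs: small weights realising it are given in
  \<open>listed_sets_realised\<close>.
\<close>

section \<open>Positivity of Kostant's partition function\<close>

lemma simple_roots_component:
  "\<alpha>\<^sub>1$1 = 1" "\<alpha>\<^sub>1$2 = -1" "\<alpha>\<^sub>1$3 = 0"
  "\<alpha>\<^sub>2$1 = 0" "\<alpha>\<^sub>2$2 = 1" "\<alpha>\<^sub>2$3 = -1"
  "\<alpha>\<^sub>3$1 = 0" "\<alpha>\<^sub>3$2 = 0" "\<alpha>\<^sub>3$3 = 2"
  by (simp_all add: \<alpha>\<^sub>1_def \<alpha>\<^sub>2_def \<alpha>\<^sub>3_def axis_def)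

text \<open>
  The name refers to the monoid generated by the positive roots; since the simple roots are
  positive roots and generate the others, they generate the same monoid.
\<close>
definition in_root_monoid :: "real^3 \<Rightarrow> bool" where
  "in_root_monoid v \<longleftrightarrow> (\<exists>a b c :: nat. v = real a *\<^sub>R \<alpha>\<^sub>1 + real b *\<^sub>R \<alpha>\<^sub>2 + real c *\<^sub>R \<alpha>\<^sub>3)"

lemma in_root_monoidI:
  "v = real a *\<^sub>R \<alpha>\<^sub>1 + real b *\<^sub>R \<alpha>\<^sub>2 + real c *\<^sub>R \<alpha>\<^sub>3 \<Longrightarrow> in_root_monoid v"
  unfolding in_root_monoid_def by blast

lemma in_root_monoid_add:
  assumes "in_root_monoid v" "in_root_monoid w"
  shows "in_root_monoid (v + w)"
proof -
  obtain a b c a' b' c' :: nat where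
    "v = real a *\<^sub>R \<alpha>\<^sub>1 + real b *\<^sub>R \<alpha>\<^sub>2 + real c *\<^sub>R \<alpha>\<^sub>3"
    "w = real a' *\<^sub>R \<alpha>\<^sub>1 + real b' *\<^sub>R \<alpha>\<^sub>2 + real c' *\<^sub>R \<alpha>\<^sub>3"
    using assms unfolding in_root_monoid_def by blast
  then show ?thesis
    by (intro in_root_monoidI[of _ "a + a'" "b + b'" "c + c'"]) (simp add: algebra_simps)
qed

lemma in_root_monoid_scale:
  assumes "in_root_monoid v"
  shows "in_root_monoid (real n *\<^sub>R v)"
proof -
  obtain a b c :: nat where "v = real a *\<^sub>R \<alpha>\<^sub>1 + real b *\<^sub>R \<alpha>\<^sub>2 + real c *\<^sub>R \<alpha>\<^sub>3"
    using assms unfolding in_root_monoid_def by blast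
  then show ?thesis
    by (intro in_root_monoidI[of _ "n * a" "n * b" "n * c"]) (simp add: algebra_simps)
qed

lemma in_root_monoid_sum:
  assumes "finite I" "\<And>i. i \<in> I \<Longrightarrow> in_root_monoid (f i)"
  shows "in_root_monoid (\<Sum>i\<in>I. f i)"
  using assms
proof (induction I rule: finite_induct)
  case empty
  show ?case
    by (rule in_root_monoidI[of _ 0 0 0]) simp
qed (simp add: in_root_monoid_add)

lemma pos_roots_in_root_monoid: "\<alpha> \<in> pos_roots \<Longrightarrow> in_root_monoid \<alpha>"
  unfolding pos_roots_def
  by (elim insertE emptyE; hypsubst)
    (rule in_root_monoidI[of _ 1 0 0] in_root_monoidI[of _ 0 1 0] in_root_monoidI[of _ 0 0 1]
       in_root_monoidI[of _ 1 1 0] in_root_monoidI[of _ 0 1 1] in_root_monoidI[of _ 1 1 1]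
       in_root_monoidI[of _ 1 2 1] in_root_monoidI[of _ 2 2 1] in_root_monoidI[of _ 0 2 1];
     simp; fail)+

lemma finite_pos_roots: "finite pos_roots"
  by (simp add: pos_roots_def)

text \<open>
  The functional is the inner product with \<open>\<rho> = (3, 2, 1)\<close>. Being at least 1 on every
  positive root, it bounds the coefficients of any partition.
\<close>
lemma pos_root_height_ge_1: "\<alpha> \<in> pos_roots \<Longrightarrow> 3 * \<alpha>$1 + 2 * \<alpha>$2 + \<alpha>$3 \<ge> 1"
  by (auto simp: pos_roots_def simple_roots_component)

lemma finite_root_partitions:
  "finite {c \<in> pos_roots \<rightarrow>\<^sub>E (UNIV :: nat set). (\<Sum>\<alpha>\<in>pos_roots. real (c \<alpha>) *\<^sub>R \<alpha>) = \<xi>}"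
proof (rule finite_subset)
  define h :: "real^3 \<Rightarrow> real" where "h v = 3 * v$1 + 2 * v$2 + v$3" for v
  have h_sum: "h (\<Sum>\<alpha>\<in>pos_roots. real (c \<alpha>) *\<^sub>R \<alpha>) = (\<Sum>\<alpha>\<in>pos_roots. real (c \<alpha>) * h \<alpha>)"
    for c :: "real^3 \<Rightarrow> nat"
    by (simp add: h_def sum.distrib sum_distrib_left algebra_simps)
  have bound: "c \<alpha> \<le> nat \<lfloor>h \<xi>\<rfloor>"
    if \<alpha>: "\<alpha> \<in> pos_roots" and c: "(\<Sum>\<alpha>\<in>pos_roots. real (c \<alpha>) *\<^sub>R \<alpha>) = \<xi>"
    for c :: "real^3 \<Rightarrow> nat" and \<alpha>
  proof -
    have h_ge: "h \<beta> \<ge> 1" if "\<beta> \<in> pos_roots" for \<beta>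
      using pos_root_height_ge_1[OF that] by (simp add: h_def)
    have "real (c \<alpha>) \<le> real (c \<alpha>) * h \<alpha>"
      using h_ge[OF \<alpha>] by (simp add: mult_le_cancel_left1)
    also have "\<dots> \<le> (\<Sum>\<beta>\<in>pos_roots. real (c \<beta>) * h \<beta>)"
      using h_ge by (intro member_le_sum \<alpha> finite_pos_roots) force
    also have "\<dots> = h \<xi>"
      by (simp only: c flip: h_sum)
    finally show ?thesis
      by (rule le_nat_floor)
  qed
  show "{c \<in> pos_roots \<rightarrow>\<^sub>E (UNIV :: nat set). (\<Sum>\<alpha>\<in>pos_roots. real (c \<alpha>) *\<^sub>R \<alpha>) = \<xi>}
    \<subseteq> pos_roots \<rightarrow>\<^sub>E {..nat \<lfloor>h \<xi>\<rfloor>}"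
  proof (intro subsetI PiE_I)
    fix c \<alpha>
    assume c: "c \<in> {c \<in> pos_roots \<rightarrow>\<^sub>E (UNIV :: nat set). (\<Sum>\<alpha>\<in>pos_roots. real (c \<alpha>) *\<^sub>R \<alpha>) = \<xi>}"
    show "c \<alpha> \<in> {..nat \<lfloor>h \<xi>\<rfloor>}" if "\<alpha> \<in> pos_roots"
      using bound[OF that] c by blast
    show "c \<alpha> = undefined" if "\<alpha> \<notin> pos_roots"
      using c that by (blast intro: PiE_arb)
  qed
  show "finite (pos_roots \<rightarrow>\<^sub>E {..nat \<lfloor>h \<xi>\<rfloor>})"
    by (intro finite_PiE finite_pos_roots) simp
qed

lemma simple_roots_combination:
  obtains c where "c \<in> pos_roots \<rightarrow>\<^sub>E (UNIV :: nat set)"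
    "(\<Sum>\<alpha>\<in>pos_roots. real (c \<alpha>) *\<^sub>R \<alpha>) = real a *\<^sub>R \<alpha>\<^sub>1 + real b *\<^sub>R \<alpha>\<^sub>2 + real d *\<^sub>R \<alpha>\<^sub>3"
proof -
  define c where "c = (\<lambda>\<alpha>\<in>pos_roots.
    if \<alpha> = \<alpha>\<^sub>1 then a else if \<alpha> = \<alpha>\<^sub>2 then b else if \<alpha> = \<alpha>\<^sub>3 then d else 0)"
  have neq: "\<alpha>\<^sub>1 \<noteq> \<alpha>\<^sub>2" "\<alpha>\<^sub>1 \<noteq> \<alpha>\<^sub>3" "\<alpha>\<^sub>2 \<noteq> \<alpha>\<^sub>3"
    by (auto simp: vec_eq_iff forall_3 simple_roots_component)
  have simple: "{\<alpha>\<^sub>1, \<alpha>\<^sub>2, \<alpha>\<^sub>3} \<subseteq> pos_roots"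
    by (simp add: pos_roots_def)
  have "(\<Sum>\<alpha>\<in>pos_roots. real (c \<alpha>) *\<^sub>R \<alpha>) = (\<Sum>\<alpha>\<in>{\<alpha>\<^sub>1, \<alpha>\<^sub>2, \<alpha>\<^sub>3}. real (c \<alpha>) *\<^sub>R \<alpha>)"
    using finite_pos_roots simple by (intro sum.mono_neutral_right) (auto simp: c_def)
  also have "\<dots> = real a *\<^sub>R \<alpha>\<^sub>1 + real b *\<^sub>R \<alpha>\<^sub>2 + real d *\<^sub>R \<alpha>\<^sub>3"
    using neq simple by (simp add: c_def add.assoc)
  finally show thesis
    by (intro that[of c]) (simp_all add: c_def)
qed

text \<open>
  A partition with arbitrary positive roots is rewritten in simple roots, and a combination of
  simple roots is already a partition. Finiteness of the set of partitions is what makes its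
  cardinality positive once it is nonempty.
\<close>
lemma kostant_partition_pos_iff: "kostant_partition \<xi> > 0 \<longleftrightarrow> in_root_monoid \<xi>"
proof
  assume "kostant_partition \<xi> > 0"
  then have "{c \<in> pos_roots \<rightarrow>\<^sub>E (UNIV :: nat set). (\<Sum>\<alpha>\<in>pos_roots. real (c \<alpha>) *\<^sub>R \<alpha>) = \<xi>} \<noteq> {}"
    unfolding kostant_partition_def card_gt_0_iff by blast
  then obtain c :: "real^3 \<Rightarrow> nat" where "\<xi> = (\<Sum>\<alpha>\<in>pos_roots. real (c \<alpha>) *\<^sub>R \<alpha>)"
    by blast
  then show "in_root_monoid \<xi>"
    by (simp add: in_root_monoid_sum in_root_monoid_scale pos_roots_in_root_monoid finite_pos_roots)
next
  assume "in_root_monoid \<xi>"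
  then obtain a b d where "\<xi> = real a *\<^sub>R \<alpha>\<^sub>1 + real b *\<^sub>R \<alpha>\<^sub>2 + real d *\<^sub>R \<alpha>\<^sub>3"
    unfolding in_root_monoid_def by blast
  then show "kostant_partition \<xi> > 0"
    unfolding kostant_partition_def card_gt_0_iff
    using simple_roots_combination[of a b d] finite_root_partitions by fastforce
qed

section \<open>The Weyl group as signed permutations\<close>

lemma simple_reflections_component:
  "s\<^sub>1 v = vector [v$2, v$1, v$3]"
  "s\<^sub>2 v = vector [v$1, v$3, v$2]"
  "s\<^sub>3 v = vector [v$1, v$2, - v$3]"
  by (simp_all add: s\<^sub>1_def s\<^sub>2_def s\<^sub>3_def refl_orth_def inner_vec_def sum_3 vec_eq_iff forall_3
      simple_roots_component diff_divide_distrib)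

text \<open>
  Sources of the coordinates are recorded by \<open>\<pi>\<close> and their signs by \<open>\<epsilon>\<close>. On a finite index
  type injectivity suffices for \<open>\<pi>\<close> to be a permutation.
\<close>
definition signed_permutation :: "(real^3 \<Rightarrow> real^3) \<Rightarrow> bool" where
  "signed_permutation \<sigma> \<longleftrightarrow> (\<exists>\<pi> \<epsilon>. inj \<pi> \<and> range \<epsilon> \<subseteq> {1, -1} \<and> (\<forall>v i. \<sigma> v $ i = \<epsilon> i * v $ \<pi> i))"

lemma signed_permutation_id: "signed_permutation id"
  unfolding signed_permutation_def
  by (rule exI[of _ id], rule exI[of _ "\<lambda>_. 1"]) simp

lemma signed_permutation_comp:
  assumes "signed_permutation \<sigma>" "signed_permutation \<tau>"
  shows "signed_permutation (\<sigma> \<circ> \<tau>)"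
proof -
  obtain \<pi> \<epsilon> where 1: "inj \<pi>" "range \<epsilon> \<subseteq> {1, -1}" "\<And>v i. \<sigma> v $ i = \<epsilon> i * v $ \<pi> i"
    using assms(1) unfolding signed_permutation_def by blast
  obtain \<pi>' \<epsilon>' where 2: "inj \<pi>'" "range \<epsilon>' \<subseteq> {1, -1}" "\<And>v i. \<tau> v $ i = \<epsilon>' i * v $ \<pi>' i"
    using assms(2) unfolding signed_permutation_def by blast
  have "inj (\<pi>' \<circ> \<pi>)"
    using 1(1) 2(1) by (rule inj_compose[rotated])
  moreover have "range (\<lambda>i. \<epsilon> i * \<epsilon>' (\<pi> i)) \<subseteq> {1, -1}"
    using 1(2) 2(2) by (fastforce simp: image_subset_iff)
  moreover have "(\<sigma> \<circ> \<tau>) v $ i = \<epsilon> i * \<epsilon>' (\<pi> i) * v $ (\<pi>' \<circ> \<pi>) i" for v i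
    by (simp add: 1(3) 2(3))
  ultimately show ?thesis
    unfolding signed_permutation_def by blast
qed

lemma signed_permutation_simple_reflections:
  "signed_permutation s\<^sub>1" "signed_permutation s\<^sub>2" "signed_permutation s\<^sub>3"
proof -
  show "signed_permutation s\<^sub>1"
    unfolding signed_permutation_def
    by (rule exI[of _ "Transposition.transpose 1 2"], rule exI[of _ "\<lambda>_. 1"])
      (simp add: forall_3 simple_reflections_component Transposition.transpose_def)
  show "signed_permutation s\<^sub>2"
    unfolding signed_permutation_def
    by (rule exI[of _ "Transposition.transpose 2 3"], rule exI[of _ "\<lambda>_. 1"])
      (simp add: forall_3 simple_reflections_component Transposition.transpose_def)
  show "signed_permutation s\<^sub>3"
    unfolding signed_permutation_def
    by (rule exI[of _ id], rule exI[of _ "\<lambda>i. if i = 3 then -1 else 1"])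
      (auto simp: forall_3 simple_reflections_component)
qed

lemma BijGroup_one: "\<one>\<^bsub>BijGroup UNIV\<^esub> = id"
  by (simp add: BijGroup_def fun_eq_iff)

lemma simple_reflection_self_inverse:
  assumes "s \<in> {s\<^sub>1, s\<^sub>2, s\<^sub>3}"
  shows "inv\<^bsub>BijGroup UNIV\<^esub> s = s"
proof -
  have s: "s \<in> carrier (BijGroup UNIV)"
    using assms simple_reflections_in_BijGroup by blast
  have "s \<circ> s = id"
    using assms by (auto simp: fun_eq_iff s\<^sub>1_def s\<^sub>2_def s\<^sub>3_def refl_orth_involutive)
  then have "s \<otimes>\<^bsub>BijGroup UNIV\<^esub> s = \<one>\<^bsub>BijGroup UNIV\<^esub>"
    by (simp add: BijGroup_mult_eq_comp[OF s s] BijGroup_one)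
  then show ?thesis
    using group.inv_equality[OF group_BijGroup] s by blast
qed

lemma weyl_group_signed_permutation:
  assumes "\<sigma> \<in> weyl_group"
  shows "signed_permutation \<sigma>"
proof -
  have "\<sigma> \<in> generate (BijGroup UNIV) {s\<^sub>1, s\<^sub>2, s\<^sub>3}"
    using assms by (simp add: weyl_group_def)
  then show ?thesis
  proof (induction rule: generate.induct)
    case one
    then show ?case
      unfolding BijGroup_one by (rule signed_permutation_id)
  next
    case (incl h)
    then show ?case
      using signed_permutation_simple_reflections by blast
  next
    case (inv h)
    then show ?case
      using signed_permutation_simple_reflections simple_reflection_self_inverse by force
  next
    case (eng g h)
    then have "g \<in> carrier (BijGroup UNIV)" "h \<in> carrier (BijGroup UNIV)"
      using group.generate_in_carrier[OF group_BijGroup simple_reflections_in_BijGroup] by blast+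
    with eng show ?case
      by (metis BijGroup_mult_eq_comp signed_permutation_comp)
  qed
qed

lemma weyl_group_comp:
  assumes "\<sigma> \<in> weyl_group" "\<tau> \<in> weyl_group"
  shows "\<sigma> \<circ> \<tau> \<in> weyl_group"
proof -
  have "\<sigma> \<otimes>\<^bsub>BijGroup UNIV\<^esub> \<tau> \<in> weyl_group"
    using assms unfolding weyl_group_def by (rule generate.eng)
  moreover have "\<sigma> \<in> carrier (BijGroup UNIV)" "\<tau> \<in> carrier (BijGroup UNIV)"
    using assms group.generate_in_carrier[OF group_BijGroup simple_reflections_in_BijGroup]
    by (simp_all add: weyl_group_def)
  ultimately show ?thesis
    by (simp add: BijGroup_mult_eq_comp)
qed

lemma simple_reflections_in_weyl_group:
  "s\<^sub>1 \<in> weyl_group" "s\<^sub>2 \<in> weyl_group" "s\<^sub>3 \<in> weyl_group"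
  unfolding weyl_group_def by (auto intro: generate.incl)

lemma id_in_weyl_group: "id \<in> weyl_group"
  using generate.one[of "BijGroup UNIV"] by (simp add: weyl_group_def BijGroup_one)

section \<open>The lettered elements\<close>

abbreviation letters :: "(real^3 \<Rightarrow> real^3) list" where
  "letters \<equiv> [w\<^sub>A, w\<^sub>B, w\<^sub>C, w\<^sub>D, w\<^sub>E, w\<^sub>F, w\<^sub>G, w\<^sub>H, w\<^sub>I, w\<^sub>J, w\<^sub>K, w\<^sub>L, w\<^sub>M, w\<^sub>N, w\<^sub>O, w\<^sub>P, w\<^sub>Q]"

lemmas letter_defs = w\<^sub>A_def w\<^sub>B_def w\<^sub>C_def w\<^sub>D_def w\<^sub>E_def w\<^sub>F_def w\<^sub>G_def w\<^sub>H_def w\<^sub>I_def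
  w\<^sub>J_def w\<^sub>K_def w\<^sub>L_def w\<^sub>M_def w\<^sub>N_def w\<^sub>O_def w\<^sub>P_def w\<^sub>Q_def

lemma letters_apply:
  "w\<^sub>A v = vector [v$1, v$2, v$3]"
  "w\<^sub>B v = vector [v$2, v$1, v$3]"
  "w\<^sub>C v = vector [v$1, v$3, v$2]"
  "w\<^sub>D v = vector [v$1, v$2, - v$3]"
  "w\<^sub>E v = vector [v$3, v$1, v$2]"
  "w\<^sub>F v = vector [v$2, v$3, v$1]"
  "w\<^sub>G v = vector [v$1, - v$3, v$2]"
  "w\<^sub>H v = vector [v$2, v$1, - v$3]"
  "w\<^sub>I v = vector [v$1, v$3, - v$2]"
  "w\<^sub>J v = vector [v$3, v$2, v$1]"
  "w\<^sub>K v = vector [v$2, - v$3, v$1]"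
  "w\<^sub>L v = vector [v$1, - v$2, v$3]"
  "w\<^sub>M v = vector [v$2, v$3, - v$1]"
  "w\<^sub>N v = vector [v$3, v$1, - v$2]"
  "w\<^sub>O v = vector [v$1, - v$3, - v$2]"
  "w\<^sub>P v = vector [v$3, v$2, - v$1]"
  "w\<^sub>Q v = vector [v$1, - v$2, - v$3]"
  by (simp_all add: letter_defs simple_reflections_component vec_eq_iff forall_3)

lemma letters_in_weyl_group: "set letters \<subseteq> weyl_group"
  by (simp add: letter_defs id_in_weyl_group simple_reflections_in_weyl_group weyl_group_comp)

text \<open>The letters are told apart by where they send \<open>(1, 2, 3)\<close>.\<close>
lemma distinct_letters: "distinct letters"
proof -
  have "distinct (map (\<lambda>w. let v = w (vector [1, 2, 3]) in (v$1, v$2, v$3)) letters)"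
    by (simp add: letters_apply)
  then show ?thesis
    unfolding distinct_map by blast
qed

text \<open>
  The reversed list contributes each inequation in the opposite orientation, so that the
  simplifier decides every equation between letters.
\<close>
lemmas letters_neq = distinct_letters[simplified]
  distinct_rev[of letters, THEN iffD2, OF distinct_letters, simplified]

section \<open>Membership as a comparison of partial sums\<close>

text \<open>
  Up to integrality this says that \<open>v - u\<close> is a nonnegative combination of
  simple roots. It is the dominance order on coordinate vectors, except that the totals need
  not agree.
\<close>
definition dominates :: "real^3 \<Rightarrow> real^3 \<Rightarrow> bool" where
  "dominates v u \<longleftrightarrow>
    u$1 \<le> v$1 \<and> u$1 + u$2 \<le> v$1 + v$2 \<and> u$1 + u$2 + u$3 \<le> v$1 + v$2 + v$3"

text \<open>
  Checking all 48 signed permutations: those outside the list make some partial sum of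
  \<open>\<sigma> l\<close> negative, because \<open>l\<close> is positive and decreasing.
\<close>
lemma signed_permutation_dominates_imp_letter:
  assumes "signed_permutation \<sigma>" and l: "l$1 > l$2" "l$2 > l$3" "l$3 > 0"
    and u: "u$1 > 0" "u$2 > 0" "u$3 > 0"
    and dom: "dominates (\<sigma> l) u"
  shows "\<sigma> \<in> set letters"
proof -
  obtain \<pi> \<epsilon> where inj: "inj \<pi>" and \<epsilon>: "range \<epsilon> \<subseteq> {1, -1}" and \<sigma>: "\<And>v i. \<sigma> v $ i = \<epsilon> i * v $ \<pi> i"
    using assms(1) unfolding signed_permutation_def by blast
  have \<sigma>_eq: "\<sigma> = (\<lambda>v. vector [\<epsilon> 1 * v $ \<pi> 1, \<epsilon> 2 * v $ \<pi> 2, \<epsilon> 3 * v $ \<pi> 3])"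
    by (simp add: fun_eq_iff vec_eq_iff forall_3 \<sigma>)
  have signs: "\<epsilon> 1 = 1 \<or> \<epsilon> 1 = -1" "\<epsilon> 2 = 1 \<or> \<epsilon> 2 = -1" "\<epsilon> 3 = 1 \<or> \<epsilon> 3 = -1"
    using \<epsilon> by auto
  have neq: "\<pi> 1 \<noteq> \<pi> 2" "\<pi> 1 \<noteq> \<pi> 3" "\<pi> 2 \<noteq> \<pi> 3"
    using inj by (simp_all add: inj_eq)
  have perm: "\<pi> 1 = 1 \<and> \<pi> 2 = 2 \<and> \<pi> 3 = 3 \<or> \<pi> 1 = 1 \<and> \<pi> 2 = 3 \<and> \<pi> 3 = 2 \<or>
    \<pi> 1 = 2 \<and> \<pi> 2 = 1 \<and> \<pi> 3 = 3 \<or> \<pi> 1 = 2 \<and> \<pi> 2 = 3 \<and> \<pi> 3 = 1 \<or>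
    \<pi> 1 = 3 \<and> \<pi> 2 = 1 \<and> \<pi> 3 = 2 \<or> \<pi> 1 = 3 \<and> \<pi> 2 = 2 \<and> \<pi> 3 = 1"
    using exhaust_3[of "\<pi> 1"] exhaust_3[of "\<pi> 2"] exhaust_3[of "\<pi> 3"] neq by metis
  have ineqs: "u$1 \<le> \<epsilon> 1 * l $ \<pi> 1" "u$1 + u$2 \<le> \<epsilon> 1 * l $ \<pi> 1 + \<epsilon> 2 * l $ \<pi> 2"
    "u$1 + u$2 + u$3 \<le> \<epsilon> 1 * l $ \<pi> 1 + \<epsilon> 2 * l $ \<pi> 2 + \<epsilon> 3 * l $ \<pi> 3"
    using dom by (simp_all add: dominates_def \<sigma>)
  show ?thesis
    unfolding \<sigma>_eq using perm signs ineqs l u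
    by (elim disjE conjE) (simp_all add: fun_eq_iff letters_apply)
qed


text \<open>
  The coordinates of a dominant weight shifted by \<open>\<rho>\<close>; they are positive and strictly
  decreasing.
\<close>
definition shifted_weight :: "nat \<Rightarrow> nat \<Rightarrow> nat \<Rightarrow> real^3" where
  "shifted_weight a b c = vector [real (a + b + c + 3), real (b + c + 2), real (c + 1)]"

lemma dominant_weight_plus_rho: "dominant_weight a b c + \<rho> = shifted_weight a b c"
  by (simp add: dominant_weight_def shifted_weight_def rho_eq(2) \<omega>\<^sub>1_def \<omega>\<^sub>2_def \<omega>\<^sub>3_def
      vec_eq_iff forall_3 simple_roots_component algebra_simps)

text \<open>
  The coefficients of \<open>v\<close> on the simple roots are its first two partial sums and half of its
  total. Evenness of the total makes the last one integral.
\<close>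
lemma in_root_monoid_iff_dominates:
  assumes v: "\<And>i. v $ i = of_int (w i)" and even: "even (\<Sum>i\<in>UNIV. w i)"
  shows "in_root_monoid v \<longleftrightarrow> dominates v 0"
proof
  assume "in_root_monoid v"
  then show "dominates v 0"
    by (auto simp: in_root_monoid_def dominates_def simple_roots_component)
next
  assume dom: "dominates v 0"
  obtain t where t: "w 1 + w 2 + w 3 = 2 * t"
    using even unfolding sum_3 by (rule evenE)
  have nonneg: "0 \<le> w 1" "0 \<le> w 1 + w 2" "0 \<le> t"
    using dom t by (simp_all add: dominates_def v flip: of_int_add)
  have "real_of_int (w 3) = 2 * real_of_int t - real_of_int (w 1) - real_of_int (w 2)"
    using t by linarith
  then show "in_root_monoid v"
    using nonneg
    by (intro in_root_monoidI[of _ "nat (w 1)" "nat (w 1 + w 2)" "nat t"])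
      (simp add: vec_eq_iff forall_3 simple_roots_component v)
qed

text \<open>Permuting keeps the sum, and each change of sign alters it by twice an integer.\<close>
lemma even_sum_signed_permutation:
  fixes w :: "3 \<Rightarrow> int" and \<pi> :: "3 \<Rightarrow> 3"
  assumes "inj \<pi>" "\<And>i. e i = 1 \<or> e i = -1"
  shows "even (\<Sum>i\<in>UNIV. e i * w (\<pi> i)) \<longleftrightarrow> even (\<Sum>i\<in>UNIV. w i)"
proof -
  have "(\<Sum>i\<in>UNIV. w i) = (\<Sum>i\<in>UNIV. w (\<pi> i))"
    using assms(1) finite_UNIV_inj_surj[of \<pi>] sum.reindex[of \<pi> UNIV w] by simp
  moreover have "even (e i * w (\<pi> i) - w (\<pi> i))" for i
    using assms(2)[of i] by auto
  then have "even (\<Sum>i\<in>UNIV. e i * w (\<pi> i) - w (\<pi> i))"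
    by (intro dvd_sum)
  ultimately show ?thesis
    by (simp add: sum_subtractf)
qed

text \<open>
  The parity assumption survives the application of \<open>\<sigma>\<close>, so the question for
  \<open>\<sigma> l - u\<close> never depends on integrality, only on the signs of its partial sums.
\<close>
lemma in_root_monoid_diff_iff_dominates:
  assumes "signed_permutation \<sigma>"
    and l: "\<And>i. l $ i = of_int (wl i)" and u: "\<And>i. u $ i = of_int (wu i)"
    and even: "even ((\<Sum>i\<in>UNIV. wl i) + (\<Sum>i\<in>UNIV. wu i))"
  shows "in_root_monoid (\<sigma> l - u) \<longleftrightarrow> dominates (\<sigma> l) u"
proof -
  obtain \<pi> \<epsilon> where \<pi>: "inj \<pi>" and \<epsilon>: "range \<epsilon> \<subseteq> {1, -1}"
    and \<sigma>: "\<And>v i. \<sigma> v $ i = \<epsilon> i * v $ \<pi> i"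
    using assms(1) unfolding signed_permutation_def by blast
  define e :: "3 \<Rightarrow> int" where "e i = (if \<epsilon> i = 1 then 1 else -1)" for i
  have \<epsilon>_eq: "\<epsilon> i = of_int (e i)" for i
    using \<epsilon> by (auto simp: e_def)
  have "even (\<Sum>i\<in>UNIV. e i * wl (\<pi> i)) \<longleftrightarrow> even (\<Sum>i\<in>UNIV. wl i)"
    using \<pi> by (rule even_sum_signed_permutation) (simp add: e_def)
  then have "even (\<Sum>i\<in>UNIV. e i * wl (\<pi> i) - wu i)"
    using even by (simp add: sum_subtractf)
  then have "in_root_monoid (\<sigma> l - u) \<longleftrightarrow> dominates (\<sigma> l - u) 0"
    by (rule in_root_monoid_iff_dominates[rotated]) (simp add: \<sigma> \<epsilon>_eq l u)
  then show ?thesis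
    by (auto simp: dominates_def)
qed

text \<open>
  With \<open>\<rho>\<close> absorbed in both weights, the vector tested by Kostant's partition function is
  \<open>\<sigma> (\<lambda> + \<rho>) - (\<mu> + \<rho>)\<close>. The coordinate sums of the shifted weights are congruent modulo 2 to
  \<open>m + k\<close> and \<open>x + z\<close>, hence the assumption.
\<close>
lemma weyl_alternation_set_eq:
  assumes "even (m + k + x + z)"
  shows "weyl_alternation_set (dominant_weight m n k) (dominant_weight x y z) =
    {\<sigma> \<in> set letters. dominates (\<sigma> (shifted_weight m n k)) (shifted_weight x y z)}"
proof -
  let ?l = "shifted_weight m n k" and ?u = "shifted_weight x y z"
  define c :: "nat \<Rightarrow> nat \<Rightarrow> nat \<Rightarrow> 3 \<Rightarrow> int"
    where "c = (\<lambda>a b c i. if i = 1 then int (a + b + c + 3)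
      else if i = 2 then int (b + c + 2) else int (c + 1))"
  have c: "shifted_weight a b d $ i = of_int (c a b d i)" for a b d i
    using exhaust_3[of i] by (auto simp: shifted_weight_def c_def)
  have "even ((\<Sum>i\<in>UNIV. c m n k i) + (\<Sum>i\<in>UNIV. c x y z i))"
    using assms by (simp add: sum_3 c_def) presburger
  then have "in_root_monoid (\<sigma> ?l - ?u) \<longleftrightarrow> dominates (\<sigma> ?l) ?u" if "\<sigma> \<in> weyl_group" for \<sigma>
    using in_root_monoid_diff_iff_dominates[OF weyl_group_signed_permutation[OF that]] c by blast
  moreover have "\<sigma> ?l - \<rho> - dominant_weight x y z = \<sigma> ?l - ?u" for \<sigma> :: "real^3 \<Rightarrow> real^3"
    unfolding dominant_weight_plus_rho[symmetric] by (simp add: algebra_simps)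
  ultimately have "weyl_alternation_set (dominant_weight m n k) (dominant_weight x y z) =
      {\<sigma> \<in> weyl_group. dominates (\<sigma> ?l) ?u}"
    unfolding weyl_alternation_set_def kostant_partition_pos_iff dominant_weight_plus_rho
    by (metis (no_types, lifting))
  also have "\<dots> = {\<sigma> \<in> set letters. dominates (\<sigma> ?l) ?u}"
  proof -
    have "\<sigma> \<in> set letters" if "\<sigma> \<in> weyl_group" "dominates (\<sigma> ?l) ?u" for \<sigma>
      using weyl_group_signed_permutation[OF that(1)] _ _ _ _ _ _ that(2)
      by (rule signed_permutation_dominates_imp_letter) (simp_all add: shifted_weight_def)
    then show ?thesis
      using letters_in_weyl_group by blast
  qed
  finally show ?thesis .
qed

section \<open>The constraints and their 46 models\<close>

text \<open>
  Write \<open>l = (l\<^sub>1, l\<^sub>2, l\<^sub>3)\<close> and let \<open>p\<^sub>1, p\<^sub>2, p\<^sub>3\<close> be the partial sums of \<open>u\<close>. The one-way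
  implications, apart from the one from \<open>E\<close> to \<open>F\<close>, go down in the Bruhat order. Since \<open>l\<close>
  is dominant, this increases \<open>\<sigma> l\<close> in the dominance order, so the conditions persist. The others
  have individual reasons:

  \<^item> \<open>H l = (l\<^sub>2, l\<^sub>1, - l\<^sub>3)\<close> takes its first two conditions from \<open>B\<close> and its last one from \<open>D\<close>;
  \<^item> \<open>N l = (l\<^sub>3, l\<^sub>1, - l\<^sub>2)\<close> takes its first condition from \<open>E\<close> and the others from \<open>I\<close>;
  \<^item> for \<open>E\<close> and \<open>J\<close> everything follows from the first condition \<open>l\<^sub>3 \<ge> p\<^sub>1 = u\<^sub>1\<close>: no coordinate of
    \<open>l\<close> is then smaller than any coordinate of \<open>u\<close>, which gives the conditions for \<open>F\<close>, too;
  \<^item> for \<open>O\<close> and \<open>Q\<close> everything follows from \<open>l\<^sub>1 - l\<^sub>2 - l\<^sub>3 \<ge> p\<^sub>3\<close>, and for \<open>M\<close> and \<open>P\<close> from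
    \<open>l\<^sub>2 + l\<^sub>3 - l\<^sub>1 \<ge> p\<^sub>3\<close>. These two inequalities contradict each other because \<open>p\<^sub>3 > 0\<close>.
\<close>
definition alternation_constraints :: "(real^3 \<Rightarrow> real^3) set \<Rightarrow> bool" where
  "alternation_constraints S \<longleftrightarrow> S \<subseteq> set letters \<and>
    (w\<^sub>B \<in> S \<longrightarrow> w\<^sub>A \<in> S) \<and> (w\<^sub>C \<in> S \<longrightarrow> w\<^sub>A \<in> S) \<and> (w\<^sub>D \<in> S \<longrightarrow> w\<^sub>A \<in> S) \<and>
    (w\<^sub>F \<in> S \<longrightarrow> w\<^sub>B \<in> S \<and> w\<^sub>C \<in> S) \<and>
    (w\<^sub>G \<in> S \<longrightarrow> w\<^sub>C \<in> S \<and> w\<^sub>D \<in> S) \<and>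
    (w\<^sub>I \<in> S \<longrightarrow> w\<^sub>C \<in> S \<and> w\<^sub>D \<in> S) \<and>
    (w\<^sub>H \<in> S \<longleftrightarrow> w\<^sub>B \<in> S \<and> w\<^sub>D \<in> S) \<and>
    (w\<^sub>E \<in> S \<longrightarrow> w\<^sub>F \<in> S) \<and>
    (w\<^sub>J \<in> S \<longleftrightarrow> w\<^sub>E \<in> S) \<and>
    (w\<^sub>N \<in> S \<longleftrightarrow> w\<^sub>E \<in> S \<and> w\<^sub>I \<in> S) \<and>
    (w\<^sub>K \<in> S \<longrightarrow> w\<^sub>F \<in> S \<and> w\<^sub>G \<in> S) \<and>
    (w\<^sub>L \<in> S \<longrightarrow> w\<^sub>I \<in> S \<and> w\<^sub>G \<in> S) \<and>
    (w\<^sub>Q \<in> S \<longrightarrow> w\<^sub>L \<in> S) \<and>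
    (w\<^sub>O \<in> S \<longleftrightarrow> w\<^sub>Q \<in> S) \<and>
    (w\<^sub>P \<in> S \<longrightarrow> w\<^sub>N \<in> S) \<and>
    (w\<^sub>M \<in> S \<longleftrightarrow> w\<^sub>P \<in> S) \<and>
    \<not> (w\<^sub>P \<in> S \<and> w\<^sub>Q \<in> S)"

lemma alternation_constraints_dominates:
  assumes l: "l$1 > l$2" "l$2 > l$3" "l$3 > 0" and u: "u$1 > u$2" "u$2 > u$3" "u$3 > 0"
  shows "alternation_constraints {\<sigma> \<in> set letters. dominates (\<sigma> l) u}"
  unfolding alternation_constraints_def
  using assms by (auto simp: letters_apply dominates_def)

definition listed_sets :: "(real^3 \<Rightarrow> real^3) set set" where
  "listed_sets = {
     {},
     {w\<^sub>A},
     {w\<^sub>C, w\<^sub>A},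
     {w\<^sub>A, w\<^sub>B},
     {w\<^sub>A, w\<^sub>D},
     {w\<^sub>C, w\<^sub>A, w\<^sub>B},
     {w\<^sub>C, w\<^sub>A, w\<^sub>D},
     {w\<^sub>C, w\<^sub>F, w\<^sub>A, w\<^sub>B},
     {w\<^sub>C, w\<^sub>A, w\<^sub>D, w\<^sub>I},
     {w\<^sub>C, w\<^sub>A, w\<^sub>D, w\<^sub>G},
     {w\<^sub>A, w\<^sub>B, w\<^sub>H, w\<^sub>D},
     {w\<^sub>C, w\<^sub>A, w\<^sub>B, w\<^sub>H, w\<^sub>D},
     {w\<^sub>C, w\<^sub>A, w\<^sub>D, w\<^sub>I, w\<^sub>G},
     {w\<^sub>J, w\<^sub>C, w\<^sub>E, w\<^sub>F, w\<^sub>A, w\<^sub>B},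
     {w\<^sub>C, w\<^sub>F, w\<^sub>A, w\<^sub>B, w\<^sub>H, w\<^sub>D},
     {w\<^sub>C, w\<^sub>A, w\<^sub>B, w\<^sub>H, w\<^sub>D, w\<^sub>I},
     {w\<^sub>C, w\<^sub>A, w\<^sub>B, w\<^sub>H, w\<^sub>D, w\<^sub>G},
     {w\<^sub>C, w\<^sub>A, w\<^sub>D, w\<^sub>I, w\<^sub>G, w\<^sub>L},
     {w\<^sub>C, w\<^sub>F, w\<^sub>A, w\<^sub>B, w\<^sub>H, w\<^sub>D, w\<^sub>I},
     {w\<^sub>C, w\<^sub>F, w\<^sub>A, w\<^sub>B, w\<^sub>H, w\<^sub>D, w\<^sub>G},
     {w\<^sub>C, w\<^sub>A, w\<^sub>B, w\<^sub>H, w\<^sub>D, w\<^sub>I, w\<^sub>G},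
     {w\<^sub>J, w\<^sub>C, w\<^sub>E, w\<^sub>F, w\<^sub>A, w\<^sub>B, w\<^sub>H, w\<^sub>D},
     {w\<^sub>C, w\<^sub>F, w\<^sub>A, w\<^sub>K, w\<^sub>B, w\<^sub>H, w\<^sub>D, w\<^sub>G},
     {w\<^sub>C, w\<^sub>F, w\<^sub>A, w\<^sub>B, w\<^sub>H, w\<^sub>D, w\<^sub>I, w\<^sub>G},
     {w\<^sub>C, w\<^sub>A, w\<^sub>B, w\<^sub>H, w\<^sub>D, w\<^sub>I, w\<^sub>G, w\<^sub>L},
     {w\<^sub>C, w\<^sub>A, w\<^sub>O, w\<^sub>D, w\<^sub>Q, w\<^sub>I, w\<^sub>G, w\<^sub>L},
     {w\<^sub>J, w\<^sub>C, w\<^sub>E, w\<^sub>F, w\<^sub>A, w\<^sub>B, w\<^sub>H, w\<^sub>D, w\<^sub>G},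
     {w\<^sub>C, w\<^sub>F, w\<^sub>A, w\<^sub>K, w\<^sub>B, w\<^sub>H, w\<^sub>D, w\<^sub>I, w\<^sub>G},
     {w\<^sub>C, w\<^sub>F, w\<^sub>A, w\<^sub>B, w\<^sub>H, w\<^sub>D, w\<^sub>I, w\<^sub>G, w\<^sub>L},
     {w\<^sub>N, w\<^sub>J, w\<^sub>C, w\<^sub>E, w\<^sub>F, w\<^sub>A, w\<^sub>B, w\<^sub>H, w\<^sub>D, w\<^sub>I},
     {w\<^sub>J, w\<^sub>C, w\<^sub>E, w\<^sub>F, w\<^sub>A, w\<^sub>K, w\<^sub>B, w\<^sub>H, w\<^sub>D, w\<^sub>G},
     {w\<^sub>C, w\<^sub>F, w\<^sub>A, w\<^sub>K, w\<^sub>B, w\<^sub>H, w\<^sub>D, w\<^sub>I, w\<^sub>G, w\<^sub>L},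
     {w\<^sub>C, w\<^sub>A, w\<^sub>B, w\<^sub>H, w\<^sub>O, w\<^sub>D, w\<^sub>Q, w\<^sub>I, w\<^sub>G, w\<^sub>L},
     {w\<^sub>N, w\<^sub>J, w\<^sub>C, w\<^sub>E, w\<^sub>F, w\<^sub>A, w\<^sub>B, w\<^sub>H, w\<^sub>D, w\<^sub>I, w\<^sub>G},
     {w\<^sub>C, w\<^sub>F, w\<^sub>A, w\<^sub>B, w\<^sub>H, w\<^sub>O, w\<^sub>D, w\<^sub>Q, w\<^sub>I, w\<^sub>G, w\<^sub>L},
     {w\<^sub>N, w\<^sub>J, w\<^sub>C, w\<^sub>E, w\<^sub>F, w\<^sub>A, w\<^sub>K, w\<^sub>B, w\<^sub>H, w\<^sub>D, w\<^sub>I, w\<^sub>G},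
     {w\<^sub>N, w\<^sub>J, w\<^sub>C, w\<^sub>E, w\<^sub>F, w\<^sub>A, w\<^sub>B, w\<^sub>P, w\<^sub>H, w\<^sub>D, w\<^sub>I, w\<^sub>M},
     {w\<^sub>N, w\<^sub>J, w\<^sub>C, w\<^sub>E, w\<^sub>F, w\<^sub>A, w\<^sub>B, w\<^sub>H, w\<^sub>D, w\<^sub>I, w\<^sub>G, w\<^sub>L},
     {w\<^sub>C, w\<^sub>F, w\<^sub>A, w\<^sub>K, w\<^sub>B, w\<^sub>H, w\<^sub>O, w\<^sub>D, w\<^sub>Q, w\<^sub>I, w\<^sub>G, w\<^sub>L},
     {w\<^sub>N, w\<^sub>J, w\<^sub>C, w\<^sub>E, w\<^sub>F, w\<^sub>A, w\<^sub>K, w\<^sub>B, w\<^sub>H, w\<^sub>D, w\<^sub>I, w\<^sub>G, w\<^sub>L},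
     {w\<^sub>N, w\<^sub>J, w\<^sub>C, w\<^sub>E, w\<^sub>F, w\<^sub>A, w\<^sub>B, w\<^sub>P, w\<^sub>H, w\<^sub>D, w\<^sub>I, w\<^sub>G, w\<^sub>M},
     {w\<^sub>N, w\<^sub>J, w\<^sub>C, w\<^sub>E, w\<^sub>F, w\<^sub>A, w\<^sub>K, w\<^sub>B, w\<^sub>P, w\<^sub>H, w\<^sub>D, w\<^sub>I, w\<^sub>G, w\<^sub>M},
     {w\<^sub>N, w\<^sub>J, w\<^sub>C, w\<^sub>E, w\<^sub>F, w\<^sub>A, w\<^sub>B, w\<^sub>P, w\<^sub>H, w\<^sub>D, w\<^sub>I, w\<^sub>G, w\<^sub>M, w\<^sub>L},
     {w\<^sub>N, w\<^sub>J, w\<^sub>C, w\<^sub>E, w\<^sub>F, w\<^sub>A, w\<^sub>B, w\<^sub>H, w\<^sub>O, w\<^sub>D, w\<^sub>Q, w\<^sub>I, w\<^sub>G, w\<^sub>L},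
     {w\<^sub>N, w\<^sub>J, w\<^sub>C, w\<^sub>E, w\<^sub>F, w\<^sub>A, w\<^sub>K, w\<^sub>B, w\<^sub>P, w\<^sub>H, w\<^sub>D, w\<^sub>I, w\<^sub>G, w\<^sub>M, w\<^sub>L},
     {w\<^sub>N, w\<^sub>J, w\<^sub>C, w\<^sub>E, w\<^sub>F, w\<^sub>A, w\<^sub>K, w\<^sub>B, w\<^sub>H, w\<^sub>O, w\<^sub>D, w\<^sub>Q, w\<^sub>I, w\<^sub>G, w\<^sub>L}}"

lemma letter_set_eq_iff:
  assumes "S \<subseteq> set letters"
  shows "S = T \<longleftrightarrow> T \<subseteq> set letters \<and> (\<forall>w\<in>set letters. w \<in> S \<longleftrightarrow> w \<in> T)"
  using assms by (auto simp del: set_simps)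

text \<open>
  Sets of letters are compared letter by letter, which turns membership in the list into a
  disjunction of 46 complete conjunctions of literals \<open>w \<in> S\<close>. What remains is a
  propositional tautology in 17 atoms.
\<close>
lemma alternation_constraints_imp_listed:
  assumes "alternation_constraints S"
  shows "S \<in> listed_sets"
  using assms
  apply (simp only: listed_sets_def alternation_constraints_def insert_iff empty_iff)
  apply (elim conjE)
  apply (simp only: letter_set_eq_iff[of S])
  apply (simp add: letters_neq del: de_Morgan_conj)
  by sat

text \<open>
  No two of the sets coincide: reading the membership pattern on the 17 letters as a binary
  number gives 46 different numbers.
\<close>
lemma card_listed_sets: "card listed_sets = 46"
proof -
  define code :: "(real^3 \<Rightarrow> real^3) set \<Rightarrow> nat"
    where "code S = horner_sum of_bool 2 (map (\<lambda>w. w \<in> S) letters)" for S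
  have "card (code ` listed_sets) = 46"
    by (simp add: listed_sets_def code_def letters_neq)
  moreover have "finite listed_sets"
    by (simp add: listed_sets_def)
  ultimately have "46 \<le> card listed_sets"
    using card_image_le by metis
  moreover have "card listed_sets \<le> 46"
    unfolding listed_sets_def by (intro card_insert_le_m1) simp_all
  ultimately show ?thesis
    by (rule order.antisym[rotated])
qed

section \<open>Realising the 46 sets\<close>

lemmas realised_simps = letters_apply dominates_def shifted_weight_def letters_neq

lemma realisedI:
  assumes "\<forall>\<sigma>\<in>set letters. dominates (\<sigma> (shifted_weight m n k)) (shifted_weight x y z) \<longleftrightarrow> \<sigma> \<in> T"
    and "T \<subseteq> set letters" and "even (m + k + x + z)"
  shows "\<exists>m n k x y z. even (m + k + x + z) \<and>
    T = weyl_alternation_set (dominant_weight m n k) (dominant_weight x y z)"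
proof -
  have "T = {\<sigma> \<in> set letters. dominates (\<sigma> (shifted_weight m n k)) (shifted_weight x y z)}"
    using assms by blast
  then have "T = weyl_alternation_set (dominant_weight m n k) (dominant_weight x y z)"
    unfolding weyl_alternation_set_eq[OF assms(3)] .
  with assms(3) show ?thesis
    by blast
qed

text \<open>
  The six numbers are \<open>m, n, k, x, y, z\<close>, one line for each set in the order of the list. They
  come from a search through small weights. The right hand parts with \<open>L\<close> and with \<open>O, Q\<close> need
  a large \<open>m\<close>, the pair \<open>M, P\<close> a large \<open>k\<close>, and \<open>K\<close> a large \<open>n\<close>, as these
  are the gaps \<open>l\<^sub>1 - l\<^sub>2 - 1\<close>, \<open>l\<^sub>3 - 1\<close> and \<open>l\<^sub>2 - l\<^sub>3 - 1\<close>.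
\<close>
lemma listed_sets_realised:
  assumes "T \<in> listed_sets"
  shows "\<exists>m n k x y z. even (m + k + x + z) \<and>
    T = weyl_alternation_set (dominant_weight m n k) (dominant_weight x y z)"
  using assms unfolding listed_sets_def
  apply (elim insertE)
  subgoal by (rule realisedI[of 0 0 0 0 1 0]) (simp_all add: realised_simps)
  subgoal by (rule realisedI[of 0 0 0 0 0 0]) (simp_all add: realised_simps)
  subgoal by (rule realisedI[of 0 0 1 1 0 0]) (simp_all add: realised_simps)
  subgoal by (rule realisedI[of 0 2 1 0 1 1]) (simp_all add: realised_simps)
  subgoal by (rule realisedI[of 0 2 0 2 0 0]) (simp_all add: realised_simps)
  subgoal by (rule realisedI[of 0 1 1 0 0 1]) (simp_all add: realised_simps)
  subgoal by (rule realisedI[of 2 0 0 0 0 0]) (simp_all add: realised_simps)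
  subgoal by (rule realisedI[of 0 0 2 0 1 0]) (simp_all add: realised_simps)
  subgoal by (rule realisedI[of 4 0 2 2 0 0]) (simp_all add: realised_simps)
  subgoal by (rule realisedI[of 3 1 0 1 0 0]) (simp_all add: realised_simps)
  subgoal by (rule realisedI[of 0 2 0 0 1 0]) (simp_all add: realised_simps)
  subgoal by (rule realisedI[of 0 1 0 0 0 0]) (simp_all add: realised_simps)
  subgoal by (rule realisedI[of 4 0 1 1 0 0]) (simp_all add: realised_simps)
  subgoal by (rule realisedI[of 0 0 3 0 0 1]) (simp_all add: realised_simps)
  subgoal by (rule realisedI[of 0 2 0 0 0 0]) (simp_all add: realised_simps)
  subgoal by (rule realisedI[of 8 1 4 0 4 0]) (simp_all add: realised_simps)
  subgoal by (rule realisedI[of 2 1 0 0 0 0]) (simp_all add: realised_simps)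
  subgoal by (rule realisedI[of 4 0 0 0 0 0]) (simp_all add: realised_simps)
  subgoal by (rule realisedI[of 3 0 2 1 0 0]) (simp_all add: realised_simps)
  subgoal by (rule realisedI[of 0 3 0 0 0 0]) (simp_all add: realised_simps)
  subgoal by (rule realisedI[of 5 1 1 0 1 0]) (simp_all add: realised_simps)
  subgoal by (rule realisedI[of 0 0 2 0 0 0]) (simp_all add: realised_simps)
  subgoal by (rule realisedI[of 0 4 0 0 0 0]) (simp_all add: realised_simps)
  subgoal by (rule realisedI[of 3 0 1 0 0 0]) (simp_all add: realised_simps)
  subgoal by (rule realisedI[of 4 1 0 0 0 0]) (simp_all add: realised_simps)
  subgoal by (rule realisedI[of 6 0 0 0 0 0]) (simp_all add: realised_simps)
  subgoal by (rule realisedI[of 0 3 2 0 0 0]) (simp_all add: realised_simps)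
  subgoal by (rule realisedI[of 3 4 1 0 0 0]) (simp_all add: realised_simps)
  subgoal by (rule realisedI[of 4 2 0 0 0 0]) (simp_all add: realised_simps)
  subgoal by (rule realisedI[of 0 0 4 0 0 0]) (simp_all add: realised_simps)
  subgoal by (rule realisedI[of 0 4 2 0 0 0]) (simp_all add: realised_simps)
  subgoal by (rule realisedI[of 4 4 0 0 0 0]) (simp_all add: realised_simps)
  subgoal by (rule realisedI[of 6 1 0 0 0 0]) (simp_all add: realised_simps)
  subgoal by (rule realisedI[of 2 1 2 0 0 0]) (simp_all add: realised_simps)
  subgoal by (rule realisedI[of 6 2 0 0 0 0]) (simp_all add: realised_simps)
  subgoal by (rule realisedI[of 0 4 4 0 0 0]) (simp_all add: realised_simps)
  subgoal by (rule realisedI[of 0 0 6 0 0 0]) (simp_all add: realised_simps)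
  subgoal by (rule realisedI[of 4 0 2 0 0 0]) (simp_all add: realised_simps)
  subgoal by (rule realisedI[of 6 4 0 0 0 0]) (simp_all add: realised_simps)
  subgoal by (rule realisedI[of 4 4 2 0 0 0]) (simp_all add: realised_simps)
  subgoal by (rule realisedI[of 0 3 6 0 0 0]) (simp_all add: realised_simps)
  subgoal by (rule realisedI[of 0 4 6 0 0 0]) (simp_all add: realised_simps)
  subgoal by (rule realisedI[of 4 0 10 0 0 0]) (simp_all add: realised_simps)
  subgoal by (rule realisedI[of 8 0 2 0 0 0]) (simp_all add: realised_simps)
  subgoal by (rule realisedI[of 8 6 14 0 0 0]) (simp_all add: realised_simps)
  subgoal by (rule realisedI[of 8 4 2 0 0 0]) (simp_all add: realised_simps)
  subgoal by simp
  done

theorem theorem5p1: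
  shows "let \<A> = {weyl_alternation_set (dominant_weight m n k) (dominant_weight x y z) |
                 m n k x y z :: nat. real (m + k + x + z) / 2 \<in> \<nat>}
    in card \<A> = 46 \<and>
       \<A> = {
         {},
         {w\<^sub>A},
         {w\<^sub>C, w\<^sub>A},
         {w\<^sub>A, w\<^sub>B},
         {w\<^sub>A, w\<^sub>D},
         {w\<^sub>C, w\<^sub>A, w\<^sub>B},
         {w\<^sub>C, w\<^sub>A, w\<^sub>D},
         {w\<^sub>C, w\<^sub>F, w\<^sub>A, w\<^sub>B},
         {w\<^sub>C, w\<^sub>A, w\<^sub>D, w\<^sub>I},
         {w\<^sub>C, w\<^sub>A, w\<^sub>D, w\<^sub>G},
         {w\<^sub>A, w\<^sub>B, w\<^sub>H, w\<^sub>D},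
         {w\<^sub>C, w\<^sub>A, w\<^sub>B, w\<^sub>H, w\<^sub>D},
         {w\<^sub>C, w\<^sub>A, w\<^sub>D, w\<^sub>I, w\<^sub>G},
         {w\<^sub>J, w\<^sub>C, w\<^sub>E, w\<^sub>F, w\<^sub>A, w\<^sub>B},
         {w\<^sub>C, w\<^sub>F, w\<^sub>A, w\<^sub>B, w\<^sub>H, w\<^sub>D},
         {w\<^sub>C, w\<^sub>A, w\<^sub>B, w\<^sub>H, w\<^sub>D, w\<^sub>I},
         {w\<^sub>C, w\<^sub>A, w\<^sub>B, w\<^sub>H, w\<^sub>D, w\<^sub>G},
         {w\<^sub>C, w\<^sub>A, w\<^sub>D, w\<^sub>I, w\<^sub>G, w\<^sub>L},
         {w\<^sub>C, w\<^sub>F, w\<^sub>A, w\<^sub>B, w\<^sub>H, w\<^sub>D, w\<^sub>I},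
         {w\<^sub>C, w\<^sub>F, w\<^sub>A, w\<^sub>B, w\<^sub>H, w\<^sub>D, w\<^sub>G},
         {w\<^sub>C, w\<^sub>A, w\<^sub>B, w\<^sub>H, w\<^sub>D, w\<^sub>I, w\<^sub>G},
         {w\<^sub>J, w\<^sub>C, w\<^sub>E, w\<^sub>F, w\<^sub>A, w\<^sub>B, w\<^sub>H, w\<^sub>D},
         {w\<^sub>C, w\<^sub>F, w\<^sub>A, w\<^sub>K, w\<^sub>B, w\<^sub>H, w\<^sub>D, w\<^sub>G},
         {w\<^sub>C, w\<^sub>F, w\<^sub>A, w\<^sub>B, w\<^sub>H, w\<^sub>D, w\<^sub>I, w\<^sub>G},
         {w\<^sub>C, w\<^sub>A, w\<^sub>B, w\<^sub>H, w\<^sub>D, w\<^sub>I, w\<^sub>G, w\<^sub>L},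
         {w\<^sub>C, w\<^sub>A, w\<^sub>O, w\<^sub>D, w\<^sub>Q, w\<^sub>I, w\<^sub>G, w\<^sub>L},
         {w\<^sub>J, w\<^sub>C, w\<^sub>E, w\<^sub>F, w\<^sub>A, w\<^sub>B, w\<^sub>H, w\<^sub>D, w\<^sub>G},
         {w\<^sub>C, w\<^sub>F, w\<^sub>A, w\<^sub>K, w\<^sub>B, w\<^sub>H, w\<^sub>D, w\<^sub>I, w\<^sub>G},
         {w\<^sub>C, w\<^sub>F, w\<^sub>A, w\<^sub>B, w\<^sub>H, w\<^sub>D, w\<^sub>I, w\<^sub>G, w\<^sub>L},
         {w\<^sub>N, w\<^sub>J, w\<^sub>C, w\<^sub>E, w\<^sub>F, w\<^sub>A, w\<^sub>B, w\<^sub>H, w\<^sub>D, w\<^sub>I},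
         {w\<^sub>J, w\<^sub>C, w\<^sub>E, w\<^sub>F, w\<^sub>A, w\<^sub>K, w\<^sub>B, w\<^sub>H, w\<^sub>D, w\<^sub>G},
         {w\<^sub>C, w\<^sub>F, w\<^sub>A, w\<^sub>K, w\<^sub>B, w\<^sub>H, w\<^sub>D, w\<^sub>I, w\<^sub>G, w\<^sub>L},
         {w\<^sub>C, w\<^sub>A, w\<^sub>B, w\<^sub>H, w\<^sub>O, w\<^sub>D, w\<^sub>Q, w\<^sub>I, w\<^sub>G, w\<^sub>L},
         {w\<^sub>N, w\<^sub>J, w\<^sub>C, w\<^sub>E, w\<^sub>F, w\<^sub>A, w\<^sub>B, w\<^sub>H, w\<^sub>D, w\<^sub>I, w\<^sub>G},
         {w\<^sub>C, w\<^sub>F, w\<^sub>A, w\<^sub>B, w\<^sub>H, w\<^sub>O, w\<^sub>D, w\<^sub>Q, w\<^sub>I, w\<^sub>G, w\<^sub>L},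
         {w\<^sub>N, w\<^sub>J, w\<^sub>C, w\<^sub>E, w\<^sub>F, w\<^sub>A, w\<^sub>K, w\<^sub>B, w\<^sub>H, w\<^sub>D, w\<^sub>I, w\<^sub>G},
         {w\<^sub>N, w\<^sub>J, w\<^sub>C, w\<^sub>E, w\<^sub>F, w\<^sub>A, w\<^sub>B, w\<^sub>P, w\<^sub>H, w\<^sub>D, w\<^sub>I, w\<^sub>M},
         {w\<^sub>N, w\<^sub>J, w\<^sub>C, w\<^sub>E, w\<^sub>F, w\<^sub>A, w\<^sub>B, w\<^sub>H, w\<^sub>D, w\<^sub>I, w\<^sub>G, w\<^sub>L},
         {w\<^sub>C, w\<^sub>F, w\<^sub>A, w\<^sub>K, w\<^sub>B, w\<^sub>H, w\<^sub>O, w\<^sub>D, w\<^sub>Q, w\<^sub>I, w\<^sub>G, w\<^sub>L},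
         {w\<^sub>N, w\<^sub>J, w\<^sub>C, w\<^sub>E, w\<^sub>F, w\<^sub>A, w\<^sub>K, w\<^sub>B, w\<^sub>H, w\<^sub>D, w\<^sub>I, w\<^sub>G, w\<^sub>L},
         {w\<^sub>N, w\<^sub>J, w\<^sub>C, w\<^sub>E, w\<^sub>F, w\<^sub>A, w\<^sub>B, w\<^sub>P, w\<^sub>H, w\<^sub>D, w\<^sub>I, w\<^sub>G, w\<^sub>M},
         {w\<^sub>N, w\<^sub>J, w\<^sub>C, w\<^sub>E, w\<^sub>F, w\<^sub>A, w\<^sub>K, w\<^sub>B, w\<^sub>P, w\<^sub>H, w\<^sub>D, w\<^sub>I, w\<^sub>G, w\<^sub>M},
         {w\<^sub>N, w\<^sub>J, w\<^sub>C, w\<^sub>E, w\<^sub>F, w\<^sub>A, w\<^sub>B, w\<^sub>P, w\<^sub>H, w\<^sub>D, w\<^sub>I, w\<^sub>G, w\<^sub>M, w\<^sub>L},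
         {w\<^sub>N, w\<^sub>J, w\<^sub>C, w\<^sub>E, w\<^sub>F, w\<^sub>A, w\<^sub>B, w\<^sub>H, w\<^sub>O, w\<^sub>D, w\<^sub>Q, w\<^sub>I, w\<^sub>G, w\<^sub>L},
         {w\<^sub>N, w\<^sub>J, w\<^sub>C, w\<^sub>E, w\<^sub>F, w\<^sub>A, w\<^sub>K, w\<^sub>B, w\<^sub>P, w\<^sub>H, w\<^sub>D, w\<^sub>I, w\<^sub>G, w\<^sub>M, w\<^sub>L},
         {w\<^sub>N, w\<^sub>J, w\<^sub>C, w\<^sub>E, w\<^sub>F, w\<^sub>A, w\<^sub>K, w\<^sub>B, w\<^sub>H, w\<^sub>O, w\<^sub>D, w\<^sub>Q, w\<^sub>I, w\<^sub>G, w\<^sub>L}}"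
proof -
  let ?\<A> = "{weyl_alternation_set (dominant_weight m n k) (dominant_weight x y z) |
    m n k x y z :: nat. real (m + k + x + z) / 2 \<in> \<nat>}"
  have parity: "real j / 2 \<in> \<nat> \<longleftrightarrow> even j" for j :: nat
  proof
    assume "real j / 2 \<in> \<nat>"
    then obtain i where "real j / 2 = real i"
      by (auto elim: Nats_cases)
    then have "real j = real (2 * i)"
      by simp
    then show "even j"
      by (metis dvd_triv_left of_nat_eq_iff)
  qed (auto elim!: evenE)
  have "?\<A> = listed_sets"
  proof (intro equalityI subsetI)
    fix S assume "S \<in> ?\<A>"
    then obtain m n k x y z where "even (m + k + x + z)"
      "S = weyl_alternation_set (dominant_weight m n k) (dominant_weight x y z)"
      unfolding parity by blast
    then have "S = {\<sigma> \<in> set letters. dominates (\<sigma> (shifted_weight m n k)) (shifted_weight x y z)}"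
      using weyl_alternation_set_eq by blast
    moreover have "alternation_constraints \<dots>"
      by (rule alternation_constraints_dominates) (simp_all add: shifted_weight_def)
    ultimately show "S \<in> listed_sets"
      using alternation_constraints_imp_listed by blast
  next
    fix T assume "T \<in> listed_sets"
    then show "T \<in> ?\<A>"
      using listed_sets_realised unfolding parity by blast
  qed
  then show ?thesis
    using card_listed_sets unfolding Let_def listed_sets_def[symmetric] by simp
qed

end
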